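(* Let $\{S_{\mathbf a^{[k]}},\ k\ge0\}$ be a non-stationary subdivision scheme reproducing $e^{\lambda x}$, $\lambda\in\mathbb C$, with respect to the shift parameter $p\in\{0,-\frac12\}$. Let $\{\phi_m,\ m\ge0\}$ be the associated sequence of basic limit functions. Assume further that $\{S_{\mathbf a^{[k]}},\ k\ge0\}$ is asymptotically similar to a convergent stationary scheme $\{S_{\mathbf a}\}$ with stable basic limit function $\phi$ having H\"older continuity $\alpha\in(0,1)$. Then $$\lim_{m\to\infty}\|\phi_m-\phi\|=0 .$$
   Context: Subdivision schemes. For each $k\ge 0$ let $\mathbf a^{[k]}=\{a^{[k]}_i\in\mathbb R,\ i\in\mathbb Z\}$ be a mask; all masks are supported in $\{-M,\dots,M\}$ for one fixed $M\in\mathbb N$. The subdivision operator is $(S_{\mathbf a^{[k]}}\mathbf f)_i=\sum_{j\in\mathbb Z}a^{[k]}_{i-2j}f_j$, $i\in\mathbb Z$. The (non-stationary) scheme $\{S_{\mathbf a^{[k]}},k\ge0\}$ is stationary, written $\{S_{\mathbf a}\}$, if all operators coincide. The symbols are $a^{[k]}(z)=\sum_i a_i^{[k]}z^i$, $z\in\mathbb C\setminus\{0\}$. The scheme is convergent if for every $\mathbf f^{[0]}\in\ell_\infty(\mathbb Z)$ there is a continuous function $g$ on $\mathbb R$ (the limit) with $\lim_{k\to\infty}\sup_{i}|g(i2^{-k})-(S_{\mathbf a^{[k-1]}}\cdots S_{\mathbf a^{[0]}}\mathbf f^{[0]})_i|=0$. For unbounded data the limit is understood locally, which makes sense because the masks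 are finitely supported. Basic limit functions. With $\boldsymbol\delta=\{\delta_{i,0},i\in\mathbb Z\}$, $\phi_m=\lim_{\ell\to\infty}S_{\mathbf a^{[m+\ell]}}\cdots S_{\mathbf a^{[m]}}\boldsymbol\delta$, $m\ge0$, i.e. the limit function of the scheme with operators $S_{\mathbf a^{[m]}},S_{\mathbf a^{[m+1]}},\dots$ applied to $\boldsymbol\delta$, meaning the continuous function $\phi_m$ on $\mathbb R$ with $\lim_{\ell\to\infty}\sup_{i\in\mathbb Z}|\phi_m(i2^{-(\ell+1)})-(S_{\mathbf a^{[m+\ell]}}\cdots S_{\mathbf a^{[m]}}\boldsymbol\delta)_i|=0$. For the stationary scheme the basic limit function is $\phi=\lim_{\ell\to\infty}S_{\mathbf a}^{\ell}\boldsymbol\delta$. Reproduction of $e^{\lambda x}$ with respect to the shift parameter $p$: the scheme is convergent, and the limit from the initial data $\{e^{\lambda(i+p)},i\in\mathbb Z\}$ is $e^{\lambda x}$; on the symbols this means $a^{[k]}(-r_k^{-1})=0$ and $a^{[k]}(r_k^{-1})=2r_k^{-p}$ for all $k\ge0$, where $r_k=e^{\lambda2^{-k-1}}$. Asymptotical similarity: $\lim_{k\to\infty}\|\mathbf a^{[k]}-\mathbf a\|=0$, with $\mathbf a$ also supported in $\{-M,\dots,M\}$. Here $\|\cdot\|$ is the supremum norm of sequences, respectively of functions on $\mathbb R$. Stable: there are constants $C_1,C_2>0$ with $C_1\|\mathbf f\|\le\|\sum_{i\in\mathbb Z}f_i\phi(\cdot-i)\|\le C_2\|\mathbf f\|$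 for all $\mathbf f\in\ell_\infty(\mathbb Z)$. *)

theory Defs
  imports "HOL-Analysis.Analysis"
begin

text \<open>Values in \<^typ>\<open>ennreal\<close>, so that the supremum of an unbounded function is infinite rather
  than unspecified.\<close>

definition sup_norm_on :: "'a set \<Rightarrow> ('a \<Rightarrow> 'b::real_normed_vector) \<Rightarrow> ennreal" where
  "sup_norm_on A f = (SUP x\<in>A. ennreal (norm (f x)))"

abbreviation sup_norm :: "('a \<Rightarrow> 'b::real_normed_vector) \<Rightarrow> ennreal" where
  "sup_norm \<equiv> sup_norm_on UNIV"

definition mask_supported :: "nat \<Rightarrow> (int \<Rightarrow> real) \<Rightarrow> bool" where
  "mask_supported M a \<longleftrightarrow> (\<forall>i. a i \<noteq> 0 \<longrightarrow> i \<in> {- int M..int M})"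

text \<open>Masks are real, but data may be complex (as needed for complex exponentials). For a finitely
  supported mask the infinite sum has finitely many nonzero terms.\<close>

definition subdiv :: "(int \<Rightarrow> real) \<Rightarrow> (int \<Rightarrow> 'a::real_normed_vector) \<Rightarrow> int \<Rightarrow> 'a" where
  "subdiv a f i = (\<Sum>\<^sub>\<infinity>j. a (i - 2 * j) *\<^sub>R f j)"

primrec subdiv_iter ::
  "(nat \<Rightarrow> int \<Rightarrow> real) \<Rightarrow> nat \<Rightarrow> (int \<Rightarrow> 'a::real_normed_vector) \<Rightarrow> int \<Rightarrow> 'a" where
  "subdiv_iter a 0 f = f"
| "subdiv_iter a (Suc k) f = subdiv (a k) (subdiv_iter a k f)"

text \<open>Uniform convergence on the dyadic grids for bounded data; for unbounded data, uniform
  convergence on the part of the grids lying in each bounded interval.\<close>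

definition is_limit_function ::
  "(nat \<Rightarrow> int \<Rightarrow> real) \<Rightarrow> (int \<Rightarrow> 'a::real_normed_vector) \<Rightarrow> (real \<Rightarrow> 'a) \<Rightarrow> bool" where
  "is_limit_function a f g \<longleftrightarrow> continuous_on UNIV g \<and>
     (if bounded (range f)
      then (\<lambda>k. sup_norm (\<lambda>i. g (of_int i / 2 ^ k) - subdiv_iter a k f i)) \<longlonglongrightarrow> 0
      else (\<forall>R>0. (\<lambda>k. sup_norm_on {i. \<bar>of_int i / 2 ^ k\<bar> \<le> (R::real)}
              (\<lambda>i. g (of_int i / 2 ^ k) - subdiv_iter a k f i)) \<longlonglongrightarrow> 0))"

definition convergent_scheme :: "(nat \<Rightarrow> int \<Rightarrow> real) \<Rightarrow> bool" where
  "convergent_scheme a \<longleftrightarrow>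
     (\<forall>f :: int \<Rightarrow> real. bounded (range f) \<longrightarrow> (\<exists>g. is_limit_function a f g))"

definition unit_seq :: "int \<Rightarrow> real" where
  "unit_seq i = (if i = 0 then 1 else 0)"

definition basic_limit_function :: "(nat \<Rightarrow> int \<Rightarrow> real) \<Rightarrow> nat \<Rightarrow> (real \<Rightarrow> real) \<Rightarrow> bool" where
  "basic_limit_function a m \<phi> \<longleftrightarrow> is_limit_function (\<lambda>l. a (m + l)) unit_seq \<phi>"

definition reproduces_exp :: "(nat \<Rightarrow> int \<Rightarrow> real) \<Rightarrow> complex \<Rightarrow> real \<Rightarrow> bool" where
  "reproduces_exp a c p \<longleftrightarrow> convergent_scheme a \<and>
     is_limit_function a (\<lambda>i. exp (c * of_real (of_int i + p))) (\<lambda>x. exp (c * of_real x))"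

definition asymptotically_similar :: "(nat \<Rightarrow> int \<Rightarrow> real) \<Rightarrow> (int \<Rightarrow> real) \<Rightarrow> bool" where
  "asymptotically_similar a b \<longleftrightarrow> (\<lambda>k. sup_norm (\<lambda>i. a k i - b i)) \<longlonglongrightarrow> 0"

text \<open>Basic limit functions of schemes with uniformly bounded mask supports are compactly supported,
  so the sum below then has finitely many nonzero terms at each \<open>x\<close>.\<close>

definition stable_shifts :: "(real \<Rightarrow> real) \<Rightarrow> bool" where
  "stable_shifts \<phi> \<longleftrightarrow> (\<exists>C1>0. \<exists>C2>0. \<forall>f :: int \<Rightarrow> real. bounded (range f) \<longrightarrow>
     ennreal C1 * sup_norm f \<le> sup_norm (\<lambda>x. \<Sum>\<^sub>\<infinity>i. f i * \<phi> (x - of_int i)) \<and>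
     sup_norm (\<lambda>x. \<Sum>\<^sub>\<infinity>i. f i * \<phi> (x - of_int i)) \<le> ennreal C2 * sup_norm f)"

definition holder_continuous :: "real \<Rightarrow> (real \<Rightarrow> real) \<Rightarrow> bool" where
  "holder_continuous \<alpha> f \<longleftrightarrow> (\<exists>C. \<forall>x y. \<bar>f x - f y\<bar> \<le> C * \<bar>x - y\<bar> powr \<alpha>)"

definition symbol :: "(int \<Rightarrow> real) \<Rightarrow> complex \<Rightarrow> complex" where
  "symbol a z = (\<Sum>\<^sub>\<infinity>i. of_real (a i) * z powi i)"

text \<open>For a convergent scheme, the conditions on the symbols at
  \<open>r = exp (c / 2 ^ (k + 1))\<close> entail reproduction; \<open>r powr (- p)\<close> is written as an exponential
  to avoid the branch cut of the complex logarithm.\<close>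

lemma subdiv_exp:
  fixes c :: complex
  assumes M: "mask_supported M a"
    and "symbol a (- inverse (exp c)) = 0"
    and "symbol a (inverse (exp c)) = 2 * exp (- of_real p * c)"
  shows "subdiv a (\<lambda>j. exp (2 * c * of_real (of_int j + p))) i = exp (c * of_real (of_int i + p))"
proof -
  let ?S = "{- int M..int M}"
  let ?E = "{n \<in> ?S. even (i - n)}"
  have fin: "finite ?E" by (rule finite_subset[of _ ?S]) auto
  let ?w = "inverse (exp c)"
  have out: "a n = 0" if "n \<notin> ?S" for n
    using M that unfolding mask_supported_def by blast
  have sym: "symbol a z = (\<Sum>n\<in>?S. of_real (a n) * z powi n)" for z
    unfolding symbol_def
    by (subst infsum_cong_neutral[where T = ?S and g = "\<lambda>n. of_real (a n) * z powi n"])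
       (use out in auto)
  have wp: "?w powi n = exp (- c * of_int n)" for n
    by (simp add: exp_power_int flip: exp_minus) (simp add: mult.commute)
  have nw: "(- ?w) powi n = (if even n then 1 else -1) * exp (- c * of_int n)" for n
    using wp[of n] power_int_minus_left[of ?w n] by auto
  have both: "(\<Sum>n\<in>?S. of_real (a n) * (if even (i - n) then 2 else 0) * exp (- c * of_int n))
      = 2 * exp (- of_real p * c)"
  proof -
    have "(\<Sum>n\<in>?S. of_real (a n) * (if even (i - n) then 2 else 0) * exp (- c * of_int n))
      = symbol a ?w + (if even i then 1 else -1) * symbol a (- ?w)"
      unfolding sym wp nw sum_distrib_left sum.distrib[symmetric]
      by (rule sum.cong) auto
    then show ?thesis using assms by simp
  qed
  have "subdiv a (\<lambda>j. exp (2 * c * of_real (of_int j + p))) i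
      = (\<Sum>\<^sub>\<infinity>j\<in>(\<lambda>n. (i - n) div 2) ` ?E. a (i - 2 * j) *\<^sub>R exp (2 * c * of_real (of_int j + p)))"
    unfolding subdiv_def
  proof (rule infsum_cong_neutral)
    fix j assume j: "j \<in> UNIV - (\<lambda>n. (i - n) div 2) ` ?E"
    have "i - 2 * j \<notin> ?S"
    proof
      assume "i - 2 * j \<in> ?S"
      then have "(i - (i - 2 * j)) div 2 \<in> (\<lambda>n. (i - n) div 2) ` ?E"
        by (intro imageI) auto
      then show False using j by simp
    qed
    then show "a (i - 2 * j) *\<^sub>R exp (2 * c * of_real (of_int j + p)) = 0"
      using out by simp
  qed auto
  also have "\<dots> = (\<Sum>j\<in>(\<lambda>n. (i - n) div 2) ` ?E. a (i - 2 * j) *\<^sub>R exp (2 * c * of_real (of_int j + p)))"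
    by (intro infsum_finite finite_imageI fin)
  also have "\<dots> = (\<Sum>n\<in>?E. of_real (a n) * (exp (- c * of_int n) * exp (c * (of_int i + 2 * of_real p))))"
  proof (subst sum.reindex)
    show "inj_on (\<lambda>n. (i - n) div 2) ?E"
    proof (rule inj_onI)
      fix x y assume "x \<in> ?E" "y \<in> ?E" and eq: "(i - x) div 2 = (i - y) div 2"
      then have "even (i - x)" "even (i - y)" by auto
      then have "i - x = i - y" using eq by (metis dvd_div_mult_self)
      then show "x = y" by simp
    qed
    show "sum ((\<lambda>j. a (i - 2 * j) *\<^sub>R exp (2 * c * of_real (of_int j + p))) \<circ> (\<lambda>n. (i - n) div 2)) ?E
      = (\<Sum>n\<in>?E. of_real (a n) * (exp (- c * of_int n) * exp (c * (of_int i + 2 * of_real p))))"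
    proof (rule sum.cong, simp)
      fix n assume "n \<in> ?E"
      then have "even (i - n)" by blast
      then obtain j where j: "i - n = 2 * j" by (rule evenE)
      then have n: "n = i - 2 * j" by simp
      show "((\<lambda>j. a (i - 2 * j) *\<^sub>R exp (2 * c * of_real (of_int j + p))) \<circ> (\<lambda>n. (i - n) div 2)) n
        = of_real (a n) * (exp (- c * of_int n) * exp (c * (of_int i + 2 * of_real p)))"
        unfolding n by (simp add: scaleR_conv_of_real algebra_simps flip: exp_add)
    qed
  qed
  also have "\<dots> = (\<Sum>n\<in>?S. of_real (a n) * (if even (i - n) then 2 else 0) * exp (- c * of_int n))
      * exp (c * (of_int i + 2 * of_real p)) / 2"
    unfolding sum_distrib_right sum_divide_distrib
    by (rule sum.mono_neutral_cong_left) auto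
  also have "\<dots> = exp (c * of_real (of_int i + p))"
    unfolding both by (simp add: algebra_simps flip: exp_add)
  finally show ?thesis .
qed

lemma reproduces_exp_if_symbol:
  assumes M: "\<And>k. mask_supported M (a k)"
    and conv: "convergent_scheme a"
    and s0: "\<And>k. symbol (a k) (- inverse (exp (c / 2 ^ (k + 1)))) = 0"
    and s1: "\<And>k. symbol (a k) (inverse (exp (c / 2 ^ (k + 1)))) = 2 * exp (- of_real p * (c / 2 ^ (k + 1)))"
  shows "reproduces_exp a c p"
proof -
  let ?f = "\<lambda>i::int. exp (c * of_real (of_int i + p))"
  let ?g = "\<lambda>x::real. exp (c * of_real x)"
  let ?d = "\<lambda>k i. ?g (of_int i / 2 ^ k) - subdiv_iter a k ?f i"
  have iter: "subdiv_iter a k ?f = (\<lambda>i. exp (c / 2 ^ k * of_real (of_int i + p)))" for k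
  proof (induction k)
    case (Suc k)
    show ?case
      using subdiv_exp[OF M s0 s1, of k]
      by (simp only: subdiv_iter.simps Suc) (simp add: fun_eq_iff)
  qed simp
  have diff: "norm (?d k i) = exp (Re c * (of_int i / 2 ^ k)) * norm (1 - exp (c * of_real p / 2 ^ k))" for k i
  proof -
    have "?d k i = ?g (of_int i / 2 ^ k) * (1 - exp (c * of_real p / 2 ^ k))"
      unfolding iter by (simp add: algebra_simps add_divide_distrib flip: exp_add)
    then show ?thesis by (simp add: norm_mult)
  qed
  have lim: "(\<lambda>k. sup_norm_on (A k) (?d k)) \<longlonglongrightarrow> 0"
    if A: "\<And>k i. i \<in> A k \<Longrightarrow> exp (Re c * (of_int i / 2 ^ k)) \<le> B" for A :: "nat \<Rightarrow> int set" and B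
  proof (rule tendsto_sandwich[OF _ _ tendsto_const])
    have "(\<lambda>k. B * norm (1 - exp (c * of_real p * inverse (2 ^ k)))) \<longlonglongrightarrow> B * norm (1 - exp (c * of_real p * (0::complex)))"
      by (intro tendsto_intros LIMSEQ_inverse_realpow_zero) 
         (use tendsto_of_real[OF LIMSEQ_inverse_realpow_zero[of 2], where 'a = complex] in simp)
    then have "(\<lambda>k. B * norm (1 - exp (c * of_real p / 2 ^ k))) \<longlonglongrightarrow> 0"
      by (simp add: divide_inverse)
    from tendsto_ennrealI[OF this]
    show "(\<lambda>k. ennreal (B * norm (1 - exp (c * of_real p / 2 ^ k)))) \<longlonglongrightarrow> 0" by simp
    show "\<forall>\<^sub>F k in sequentially. sup_norm_on (A k) (?d k) \<le> ennreal (B * norm (1 - exp (c * of_real p / 2 ^ k)))"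
      unfolding sup_norm_on_def diff
      by (intro always_eventually allI SUP_least ennreal_leI mult_right_mono A) auto
  qed auto
  have "is_limit_function a ?f ?g"
    unfolding is_limit_function_def
  proof (intro conjI)
    show "continuous_on UNIV ?g" by (intro continuous_intros)
    show "if bounded (range ?f) then (\<lambda>k. sup_norm (?d k)) \<longlonglongrightarrow> 0
      else (\<forall>R>0. (\<lambda>k. sup_norm_on {i. \<bar>of_int i / 2 ^ k\<bar> \<le> (R::real)} (?d k)) \<longlonglongrightarrow> 0)"
    proof (cases "bounded (range ?f)")
      case True
      then obtain B where "\<And>i. norm (?f i) \<le> B" by (auto simp: bounded_iff)
      then have B: "exp (Re c * (of_int i + p)) \<le> B" for i :: int by simp
      have lin: "Re c * (of_int i + p) \<le> B" for i :: int
        using B[of i] exp_ge_add_one_self[of "Re c * (of_int i + p)"] by linarith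
      have "Re c = 0"
      proof (rule ccontr)
        assume nz: "Re c \<noteq> 0"
        obtain n where n: "B - Re c * p < of_nat n * \<bar>Re c\<bar>"
          using reals_Archimedean3[of "\<bar>Re c\<bar>"] nz by auto
        show False
          using lin[of "int n"] lin[of "- int n"] n by (cases "Re c > 0") (auto simp: algebra_simps)
      qed
      then show ?thesis using True lim[of "\<lambda>_. UNIV" 1] by simp
    next
      case False
      have "(\<lambda>k. sup_norm_on {i. \<bar>of_int i / 2 ^ k\<bar> \<le> R} (?d k)) \<longlonglongrightarrow> 0" for R :: real
      proof (rule lim[where B = "exp (\<bar>Re c\<bar> * R)"])
        fix k and i :: int assume "i \<in> {i. \<bar>of_int i / 2 ^ k\<bar> \<le> R}"
        then have "\<bar>Re c\<bar> * \<bar>of_int i / 2 ^ k\<bar> \<le> \<bar>Re c\<bar> * R" by (intro mult_left_mono) auto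
        then show "exp (Re c * (of_int i / 2 ^ k)) \<le> exp (\<bar>Re c\<bar> * R)"
          unfolding abs_mult[symmetric] exp_le_cancel_iff by linarith
      qed
      then show ?thesis using False by auto
    qed
  qed
  then show ?thesis using conv by (simp add: reproduces_exp_def)
qed

end

theory Submission
  imports Defs
begin

text \<open>The proof works with the impulse responses
  \<open>u\<^bsub>m,n\<^esub> = S\<^bsub>m+n-1\<^esub> \<cdots> S\<^bsub>m\<^esub> \<delta>\<close>, whose values at \<open>l\<close> approximate \<open>\<phi>\<^sub>m (l / 2\<^sup>n)\<close>.
  By linearity and shift invariance, a cascade of \<open>n + q\<close> steps factors as
  \<open>u\<^bsub>m,n+q\<^esub> l = (\<Sum>j. u\<^bsub>m+n,q\<^esub> (l - 2\<^sup>q j) * u\<^bsub>m,n\<^esub> j)\<close>, where only a bounded number of \<open>j\<close> near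
  \<open>l / 2\<^sup>q\<close> contribute (lemma \<open>impulse_response_add\<close>).

  The right-hand factor is understood from the stationary scheme. For \<open>n\<close> fixed and large,
  \<open>S\<^sub>b\<^sup>n \<delta>\<close> samples \<open>\<phi>\<close> up to a small error, and for \<open>m\<close> large the first \<open>n\<close> non-stationary steps
  are close to \<open>S\<^sub>b\<^sup>n\<close> by asymptotical similarity. As \<open>\<phi>\<close> is uniformly continuous, all relevant
  \<open>u\<^bsub>m,n\<^esub> j\<close> are therefore close to the single number \<open>\<phi> (l / 2\<^bsup>n+q\<^esup>)\<close>.

  It remains to see that the left-hand factors \<open>u\<^bsub>m+n,q\<^esub> (l - 2\<^sup>q j)\<close> sum up to about \<open>1\<close>. This is
  where the reproduced exponential enters: the refined data it generates are, on a bounded region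
  and at late levels, close to a continuous function without zeros, hence nearly constant and away
  from \<open>0\<close> on every stencil. A scheme that sends nearly constant data to nearly the same constant
  has impulse responses that nearly form a partition of unity (lemma
  \<open>impulse_response_nearly_partition_of_unity\<close>). Without such a hypothesis the conclusion fails:
  the masks \<open>(1 - 1 / (k + 2)) b\<close> have vanishing basic limit functions.

  Together, if \<open>K\<close> bounds \<open>u\<^bsub>m+n,q\<^esub>\<close>, then \<open>u\<^bsub>m,n+q\<^esub>\<close> differs from \<open>\<phi>\<close> on the dyadic grid by at most
  \<open>\<epsilon> (K + 1)\<close> (lemma \<open>impulse_response_nearly_limit\<close>). This estimate is used twice. With
  \<open>\<epsilon> = 1 / 2\<close> it is a contraction that bounds all \<open>u\<^bsub>m,q\<^esub>\<close> with \<open>m\<close> large by one constant,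
  by induction on \<open>q\<close>. With that constant as \<open>K\<close> and \<open>\<epsilon>\<close> arbitrary, letting \<open>q\<close> tend to infinity
  gives the claim at all dyadic points, and continuity gives it everywhere.\<close>

section \<open>Convergence in the supremum norm\<close>

text \<open>Reduces limits in \<^typ>\<open>ennreal\<close> to pointwise real estimates.\<close>

lemma sup_norm_on_tendsto_0_iff:
  "(\<lambda>k. sup_norm_on (A k) (F k)) \<longlonglongrightarrow> 0 \<longleftrightarrow>
    (\<forall>e>0. \<forall>\<^sub>F k in sequentially. \<forall>x\<in>A k. norm (F k x) \<le> e)"
proof
  assume lim: "(\<lambda>k. sup_norm_on (A k) (F k)) \<longlonglongrightarrow> 0"
  show "\<forall>e>0. \<forall>\<^sub>F k in sequentially. \<forall>x\<in>A k. norm (F k x) \<le> e"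
  proof (intro allI impI)
    fix e :: real assume e: "e > 0"
    then have "\<forall>\<^sub>F k in sequentially. sup_norm_on (A k) (F k) < ennreal e"
      using lim by (intro order_tendstoD(2)) auto
    then show "\<forall>\<^sub>F k in sequentially. \<forall>x\<in>A k. norm (F k x) \<le> e"
    proof eventually_elim
      case (elim k)
      show ?case
      proof
        fix x assume "x \<in> A k"
        then have "ennreal (norm (F k x)) \<le> sup_norm_on (A k) (F k)"
          unfolding sup_norm_on_def by (rule SUP_upper)
        with elim have "ennreal (norm (F k x)) \<le> ennreal e" by simp
        then show "norm (F k x) \<le> e" using e by simp
      qed
    qed
  qed
next
  assume *: "\<forall>e>0. \<forall>\<^sub>F k in sequentially. \<forall>x\<in>A k. norm (F k x) \<le> e"
  show "(\<lambda>k. sup_norm_on (A k) (F k)) \<longlonglongrightarrow> 0"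
  proof (rule order_tendstoI)
    fix y :: ennreal assume "0 < y"
    then obtain e where e: "0 < e" "ennreal e < y"
      by (metis dense ennreal_cases ennreal_less_zero_iff not_less_iff_gr_or_eq
          top.not_eq_extremum)
    from *[rule_format, OF e(1)]
    show "\<forall>\<^sub>F k in sequentially. sup_norm_on (A k) (F k) < y"
    proof eventually_elim
      case (elim k)
      have "sup_norm_on (A k) (F k) \<le> ennreal e"
        unfolding sup_norm_on_def using elim by (intro SUP_least ennreal_leI) auto
      then show ?case using e by simp
    qed
  qed simp
qed

section \<open>Iterated subdivision as summation over a stencil\<close>

text \<open>Contains the indices of all data that can influence position \<open>l\<close> after \<open>n\<close> steps with masks
  supported in \<open>{-M..M}\<close>. The exact set of influence has a cardinality depending on \<open>l\<close>; an
  interval of constant length \<open>2 M + 2\<close> makes all sums uniformly bounded.\<close>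

definition stencil :: "nat \<Rightarrow> nat \<Rightarrow> int \<Rightarrow> int set" where
  "stencil M n l = {l div 2 ^ n - int M .. l div 2 ^ n + int M + 1}"

lemma finite_stencil [simp]: "finite (stencil M n l)"
  and card_stencil: "card (stencil M n l) = 2 * M + 2"
  by (auto simp: stencil_def)

text \<open>One step moves data by at most \<open>M\<close> on the refined grid, so that after \<open>n\<close> steps the reach is
  \<open>M (1 + 2 + \<dots> + 2\<^bsup>n-1\<^esup>) = M (2\<^sup>n - 1)\<close>.\<close>

lemma stencil_superset:
  assumes "\<bar>l - 2 ^ n * j\<bar> \<le> int M * (2 ^ n - 1)"
  shows "j \<in> stencil M n l"
proof -
  let ?p = "2 ^ n :: int" and ?d = "l div 2 ^ n"
  have p: "?p > 0" by simp
  have l: "l = ?p * ?d + l mod ?p" and r: "0 \<le> l mod ?p" "l mod ?p < ?p" by simp_all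
  have M: "int M * (?p - 1) \<le> int M * ?p" by (simp add: mult_left_mono)
  have "?p * j \<le> ?p * (?d + 1 + int M)" "?p * (?d - int M) \<le> ?p * j"
    using assms l r M unfolding abs_le_iff distrib_left right_diff_distrib by (simp_all only: mult.commute[of "int M"] mult_1_right) linarith+
  then show ?thesis using p by (simp add: stencil_def)
qed

lemma stencil_near:
  assumes "j \<in> stencil M n l"
  shows "\<bar>of_int j - of_int l / 2 ^ n\<bar> \<le> real M + 1"
proof -
  let ?p = "2 ^ n :: int" and ?d = "l div 2 ^ n"
  have "of_int l = (2 ^ n :: real) * of_int ?d + of_int (l mod ?p)"
    by (metis mult_div_mod_eq of_int_add of_int_mult of_int_numeral of_int_power)
  then have "of_int l / 2 ^ n = of_int ?d + (of_int (l mod ?p) / 2 ^ n :: real)"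
    by (simp add: field_simps)
  moreover have "0 \<le> (of_int (l mod ?p) / 2 ^ n :: real)" by simp
  moreover have "of_int (l mod ?p) / 2 ^ n < (1::real)"
  proof -
    have "l mod ?p < ?p" by simp
    then have "real_of_int (l mod ?p) < of_int ?p" by (simp only: of_int_less_iff)
    then show ?thesis by simp
  qed
  moreover have "of_int ?d - real M \<le> of_int j" "of_int j \<le> of_int ?d + real M + (1::real)"
    using assms unfolding stencil_def by auto
  ultimately show ?thesis by linarith
qed

lemma subdiv_eq_sum:
  assumes "mask_supported M a" "finite F" "\<And>j. \<bar>i - 2 * j\<bar> \<le> int M \<Longrightarrow> j \<in> F"
  shows "subdiv a f i = (\<Sum>j\<in>F. a (i - 2 * j) *\<^sub>R f j)"
proof -
  have "a (i - 2 * j) = 0" if "j \<notin> F" for j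
    using that assms(1) assms(3)[of j] unfolding mask_supported_def by fastforce
  then have "subdiv a f i = (\<Sum>\<^sub>\<infinity>j\<in>F. a (i - 2 * j) *\<^sub>R f j)"
    unfolding subdiv_def by (intro infsum_cong_neutral) auto
  then show ?thesis using assms(2) by simp
qed

lemma subdiv_eq_stencil_sum:
  assumes "mask_supported M a"
  shows "subdiv a f i = (\<Sum>j\<in>stencil M 1 i. a (i - 2 * j) *\<^sub>R f j)"
  by (rule subdiv_eq_sum[OF assms]) (auto intro!: stencil_superset)

lemma norm_stencil_sum_le:
  assumes "\<And>j. j \<in> stencil M n l \<Longrightarrow> norm (h j) \<le> B"
  shows "norm (\<Sum>j\<in>stencil M n l. h j) \<le> (2 * real M + 2) * B"
  using sum_norm_bound[of "stencil M n l" h B] assms by (simp add: card_stencil add.commute)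

definition impulse_response :: "(nat \<Rightarrow> int \<Rightarrow> real) \<Rightarrow> nat \<Rightarrow> nat \<Rightarrow> int \<Rightarrow> real" where
  "impulse_response a m n = subdiv_iter (\<lambda>l. a (m + l)) n unit_seq"

lemma impulse_response_0 [simp]: "impulse_response a m 0 = unit_seq"
  and impulse_response_Suc:
    "impulse_response a m (Suc n) = subdiv (a (m + n)) (impulse_response a m n)"
  by (simp_all add: impulse_response_def)

lemma subdiv_iter_add:
  "subdiv_iter a (m + n) f = subdiv_iter (\<lambda>l. a (m + l)) n (subdiv_iter a m f)"
  by (induction n) simp_all

lemma impulse_response_support:
  assumes "\<And>k. mask_supported M (a k)" and "impulse_response a m n l \<noteq> 0"
  shows "\<bar>l\<bar> \<le> int M * (2 ^ n - 1)"
  using assms(2)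
proof (induction n arbitrary: l)
  case 0
  then show ?case by (simp add: unit_seq_def split: if_splits)
next
  case (Suc n)
  then obtain i where i: "a (m + n) (l - 2 * i) \<noteq> 0" "impulse_response a m n i \<noteq> 0"
    unfolding impulse_response_Suc subdiv_eq_stencil_sum[OF assms(1)]
    by (metis (no_types, lifting) sum.neutral scaleR_eq_0_iff)
  have "\<bar>l - 2 * i\<bar> \<le> int M"
    using assms(1)[of "m + n"] i(1) unfolding mask_supported_def by fastforce
  moreover have "\<bar>i\<bar> \<le> int M * (2 ^ n - 1)" by (rule Suc.IH[OF i(2)])
  ultimately show ?case by (simp add: algebra_simps)
qed

text \<open>Linearity and shift invariance: refining \<open>n\<close> times commutes with a shift of the data by \<open>j\<close>,
  up to a shift of the result by \<open>2\<^sup>n j\<close>. The index set \<open>F\<close> is left arbitrary because the induction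
  compares sums at neighbouring positions \<open>i\<close>, whose stencils differ.\<close>

lemma subdiv_iter_eq_sum:
  assumes "\<And>k. mask_supported M (a k)" and "finite F"
    and "\<And>j. \<bar>l - 2 ^ n * j\<bar> \<le> int M * (2 ^ n - 1) \<Longrightarrow> j \<in> F"
  shows "subdiv_iter (\<lambda>k. a (m + k)) n f l = (\<Sum>j\<in>F. impulse_response a m n (l - 2 ^ n * j) *\<^sub>R f j)"
  using assms(3)
proof (induction n arbitrary: l)
  case 0
  have "l \<in> F" using 0[of l] by simp
  have "(\<Sum>j\<in>F. unit_seq (l - j) *\<^sub>R f j) = (\<Sum>j\<in>F. if j = l then f j else 0)"
    by (rule sum.cong) (auto simp: unit_seq_def)
  also have "\<dots> = f l" using assms(2) \<open>l \<in> F\<close> by simp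
  finally show ?case by simp
next
  case (Suc n)
  let ?I = "{i. \<bar>l - 2 * i\<bar> \<le> int M}" and ?u = "impulse_response a m n"
  have I: "finite ?I"
    by (rule finite_subset[of _ "stencil M 1 l"]) (auto intro!: stencil_superset)
  have IH: "subdiv_iter (\<lambda>k. a (m + k)) n f i = (\<Sum>j\<in>F. ?u (i - 2 ^ n * j) *\<^sub>R f j)"
    if "i \<in> ?I" for i
  proof (rule Suc.IH)
    fix j assume "\<bar>i - 2 ^ n * j\<bar> \<le> int M * (2 ^ n - 1)"
    with that have "\<bar>l - 2 ^ Suc n * j\<bar> \<le> int M * (2 ^ Suc n - 1)"
      by (simp add: algebra_simps)
    then show "j \<in> F" by (rule Suc.prems)
  qed
  have shift: "(\<Sum>i\<in>?I. a (m + n) (l - 2 * i) * ?u (i - 2 ^ n * j))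
      = impulse_response a m (Suc n) (l - 2 ^ Suc n * j)" for j
  proof -
    have "impulse_response a m (Suc n) (l - 2 ^ Suc n * j)
      = (\<Sum>i\<in>(\<lambda>i. i - 2 ^ n * j) ` ?I. a (m + n) (l - 2 ^ Suc n * j - 2 * i) *\<^sub>R ?u i)"
      unfolding impulse_response_Suc
    proof (rule subdiv_eq_sum[OF assms(1) finite_imageI[OF I]])
      fix i assume "\<bar>l - 2 ^ Suc n * j - 2 * i\<bar> \<le> int M"
      then have "i + 2 ^ n * j \<in> ?I" by (simp add: algebra_simps)
      then show "i \<in> (\<lambda>i. i - 2 ^ n * j) ` ?I" by (rule rev_image_eqI) simp
    qed
    also have "\<dots> = (\<Sum>i\<in>?I. a (m + n) (l - 2 * i) * ?u (i - 2 ^ n * j))"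
      by (subst sum.reindex) (auto simp: inj_on_def algebra_simps)
    finally show ?thesis by simp
  qed
  have "subdiv_iter (\<lambda>k. a (m + k)) (Suc n) f l
      = (\<Sum>i\<in>?I. a (m + n) (l - 2 * i) *\<^sub>R subdiv_iter (\<lambda>k. a (m + k)) n f i)"
    unfolding subdiv_iter.simps by (rule subdiv_eq_sum[OF assms(1) I]) simp
  also have "\<dots> = (\<Sum>i\<in>?I. \<Sum>j\<in>F. (a (m + n) (l - 2 * i) * ?u (i - 2 ^ n * j)) *\<^sub>R f j)"
    by (rule sum.cong[OF refl]) (simp add: IH scaleR_sum_right)
  also have "\<dots> = (\<Sum>j\<in>F. (\<Sum>i\<in>?I. a (m + n) (l - 2 * i) * ?u (i - 2 ^ n * j)) *\<^sub>R f j)"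
    by (subst sum.swap) (simp add: scaleR_sum_left)
  finally show ?case unfolding shift .
qed

corollary subdiv_iter_add_eq_stencil_sum:
  assumes "\<And>k. mask_supported M (a k)"
  shows "subdiv_iter a (m + n) f l
    = (\<Sum>j\<in>stencil M n l. impulse_response a m n (l - 2 ^ n * j) *\<^sub>R subdiv_iter a m f j)"
  unfolding subdiv_iter_add by (rule subdiv_iter_eq_sum[OF assms finite_stencil stencil_superset])

corollary impulse_response_add:
  assumes "\<And>k. mask_supported M (a k)"
  shows "impulse_response a m (n + q) l
    = (\<Sum>j\<in>stencil M q l. impulse_response a (m + n) q (l - 2 ^ q * j) * impulse_response a m n j)"
  using subdiv_iter_add_eq_stencil_sum[of M "\<lambda>k. a (m + k)" n q unit_seq l] assms
  by (simp add: impulse_response_def add.assoc)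

section \<open>Comparison with the stationary scheme over finitely many steps\<close>

lemma norm_subdiv_le:
  assumes "mask_supported M a" and "\<And>i. \<bar>a i\<bar> \<le> A" and "\<And>i. norm (f i) \<le> B"
  shows "norm (subdiv a f i) \<le> (2 * real M + 2) * (A * B)"
proof -
  have "norm (a (i - 2 * j) *\<^sub>R f j) \<le> A * B" for j
    using assms(2)[of "i - 2 * j"] assms(3)[of j] by (auto intro!: mult_mono)
  then show ?thesis
    unfolding subdiv_eq_stencil_sum[OF assms(1)] by (intro norm_stencil_sum_le)
qed

text \<open>A crude bound, exponential in \<open>n\<close>; it is only applied for \<open>n\<close> below a fixed number of steps.\<close>

lemma impulse_response_le_power:
  assumes "\<And>k. mask_supported M (a k)" and "\<And>k i. k \<ge> m0 \<Longrightarrow> \<bar>a k i\<bar> \<le> A" and "m \<ge> m0"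
  shows "\<bar>impulse_response a m n l\<bar> \<le> ((2 * real M + 2) * A) ^ n"
proof (induction n arbitrary: l)
  case 0
  then show ?case by (simp add: unit_seq_def)
next
  case (Suc n)
  have "norm (subdiv (a (m + n)) (impulse_response a m n) l)
      \<le> (2 * real M + 2) * (A * ((2 * real M + 2) * A) ^ n)"
    by (rule norm_subdiv_le[OF assms(1)]) (use Suc assms(2,3) in auto)
  then show ?case by (simp add: impulse_response_Suc mult.assoc)
qed

lemma mask_bounded:
  assumes "mask_supported M b"
  obtains B where "B \<ge> 0" "\<And>i. \<bar>b i\<bar> \<le> B"
proof
  show "0 \<le> (\<Sum>i\<in>{- int M..int M}. \<bar>b i\<bar>)" by (simp add: sum_nonneg)
  show "\<bar>b i\<bar> \<le> (\<Sum>i\<in>{- int M..int M}. \<bar>b i\<bar>)" for i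
  proof (cases "i \<in> {- int M..int M}")
    case True
    then show ?thesis by (intro member_le_sum) auto
  next
    case False
    then have "b i = 0" using assms unfolding mask_supported_def by blast
    then show ?thesis by (simp add: sum_nonneg)
  qed
qed

lemma asymptotically_similarD:
  assumes "asymptotically_similar a b" and "e > 0"
  shows "\<forall>\<^sub>F k in sequentially. \<forall>i. \<bar>a k i - b i\<bar> \<le> e"
  using assms by (simp add: asymptotically_similar_def sup_norm_on_tendsto_0_iff)

text \<open>For a fixed number of steps, the composition of operators depends continuously on the masks.\<close>

lemma impulse_response_tendsto_stationary:
  assumes a: "\<And>k. mask_supported M (a k)" and b: "mask_supported M b"
    and sim: "asymptotically_similar a b" and "e > 0"
  shows "\<forall>\<^sub>F m in sequentially. \<forall>i. \<bar>impulse_response a m n i - impulse_response (\<lambda>_. b) 0 n i\<bar> \<le> e"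
  using \<open>e > 0\<close>
proof (induction n arbitrary: e)
  case 0
  then show ?case by simp
next
  case (Suc n)
  let ?W = "2 * real M + 2" and ?s = "impulse_response (\<lambda>_. b) 0 n"
  obtain B where B: "B \<ge> 0" "\<And>i. \<bar>b i\<bar> \<le> B" using mask_bounded[OF b] by blast
  define C where "C = (?W * B) ^ n"
  have C: "\<bar>?s i\<bar> \<le> C" for i
    unfolding C_def by (rule impulse_response_le_power[where m0 = 0]) (use b B in auto)
  have C0: "C \<ge> 0" using C[of 0] by linarith
  define d where "d = e / (?W * (B + C + 1))"
  have d: "d > 0" using Suc.prems B C0 by (simp add: d_def)
  have ev: "\<forall>\<^sub>F m in sequentially. \<forall>i. \<bar>a (m + n) i - b i\<bar> \<le> min 1 d"
  proof (rule sequentially_offset[where P = "\<lambda>k. \<forall>i. \<bar>a k i - b i\<bar> \<le> min 1 d"])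
    show "\<forall>\<^sub>F k in sequentially. \<forall>i. \<bar>a k i - b i\<bar> \<le> min 1 d"
      using asymptotically_similarD[OF sim, of "min 1 d"] d by simp
  qed
  from ev Suc.IH[OF d] show ?case
  proof eventually_elim
    case (elim m)
    let ?u = "impulse_response a m n"
    show ?case
    proof
      fix i
      have split: "a (m + n) j * ?u k - b j * ?s k = a (m + n) j * (?u k - ?s k) + (a (m + n) j - b j) * ?s k"
        for j k by (simp add: algebra_simps)
      have "\<bar>a (m + n) j * ?u k - b j * ?s k\<bar> \<le> (B + 1) * d + d * C" for j k
      proof -
        have *: "\<bar>a (m + n) j\<bar> \<le> B + 1" "\<bar>a (m + n) j - b j\<bar> \<le> d"
          using elim(1)[rule_format, of j] B(2)[of j] by linarith+
        have "\<bar>a (m + n) j * (?u k - ?s k)\<bar> \<le> (B + 1) * d"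
          unfolding abs_mult using * elim(2) B by (intro mult_mono) auto
        moreover have "\<bar>(a (m + n) j - b j) * ?s k\<bar> \<le> d * C"
          unfolding abs_mult using * C d by (intro mult_mono) auto
        ultimately show ?thesis unfolding split by linarith
      qed
      then have "norm (\<Sum>j\<in>stencil M 1 i. a (m + n) (i - 2 * j) * ?u j - b (i - 2 * j) * ?s j)
          \<le> ?W * ((B + 1) * d + d * C)"
        by (intro norm_stencil_sum_le) simp
      also have "\<dots> = d * (?W * (B + C + 1))" by (simp add: algebra_simps)
      also have "\<dots> = e" using B C0 by (simp add: d_def)
      finally show "\<bar>impulse_response a m (Suc n) i - impulse_response (\<lambda>_. b) 0 (Suc n) i\<bar> \<le> e"
        unfolding impulse_response_Suc subdiv_eq_stencil_sum[OF a] subdiv_eq_stencil_sum[OF b]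
        by (simp add: sum_subtractf)
    qed
  qed
qed

section \<open>Limit functions\<close>

lemma basic_limit_functionD:
  assumes "basic_limit_function a m \<phi>"
  shows "continuous_on UNIV \<phi>"
    and "e > 0 \<Longrightarrow> \<forall>\<^sub>F n in sequentially. \<forall>i. \<bar>\<phi> (of_int i / 2 ^ n) - impulse_response a m n i\<bar> \<le> e"
proof -
  have "bounded (range unit_seq)"
    by (rule boundedI[of _ 1]) (auto simp: unit_seq_def)
  then have *: "continuous_on UNIV \<phi> \<and>
      (\<lambda>n. sup_norm (\<lambda>i. \<phi> (of_int i / 2 ^ n) - impulse_response a m n i)) \<longlonglongrightarrow> 0"
    using assms by (simp add: basic_limit_function_def is_limit_function_def impulse_response_def)
  then show "continuous_on UNIV \<phi>" by blast
  show "\<forall>\<^sub>F n in sequentially. \<forall>i. \<bar>\<phi> (of_int i / 2 ^ n) - impulse_response a m n i\<bar> \<le> e" if "e > 0"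
    using * that by (simp add: sup_norm_on_tendsto_0_iff)
qed

text \<open>Convergence on bounded regions, whichever of the two notions of convergence applies to the
  data.\<close>

lemma is_limit_function_local:
  fixes R :: real
  assumes "is_limit_function a f g" and "e > 0" and "R > 0"
  shows "\<forall>\<^sub>F k in sequentially. \<forall>i. \<bar>of_int i / 2 ^ k\<bar> \<le> R \<longrightarrow>
    norm (g (of_int i / 2 ^ k) - subdiv_iter a k f i) \<le> e"
proof (cases "bounded (range f)")
  case True
  then have "(\<lambda>k. sup_norm (\<lambda>i. g (of_int i / 2 ^ k) - subdiv_iter a k f i)) \<longlonglongrightarrow> 0"
    using assms(1) by (simp add: is_limit_function_def)
  then have "\<forall>\<^sub>F k in sequentially. \<forall>i. norm (g (of_int i / 2 ^ k) - subdiv_iter a k f i) \<le> e"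
    using assms(2) by (simp add: sup_norm_on_tendsto_0_iff)
  then show ?thesis by eventually_elim blast
next
  case False
  then have "(\<lambda>k. sup_norm_on {i. \<bar>of_int i / 2 ^ k\<bar> \<le> R}
      (\<lambda>i. g (of_int i / 2 ^ k) - subdiv_iter a k f i)) \<longlonglongrightarrow> 0"
    using assms(1,3) unfolding is_limit_function_def by (simp del: abs_divide)
  then show ?thesis using assms(2) unfolding sup_norm_on_tendsto_0_iff by simp
qed

text \<open>The upper stability estimate for the data \<open>\<delta>\<close>, whose series is \<open>\<phi>\<close> itself.\<close>

lemma stable_shifts_bounded:
  assumes "stable_shifts \<phi>"
  obtains C where "C \<ge> 0" "\<And>x. \<bar>\<phi> x\<bar> \<le> C"
proof -
  obtain C2 where C2: "C2 > 0" and le: "\<And>f :: int \<Rightarrow> real. bounded (range f) \<Longrightarrow>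
      sup_norm (\<lambda>x. \<Sum>\<^sub>\<infinity>i. f i * \<phi> (x - of_int i)) \<le> ennreal C2 * sup_norm f"
    using assms unfolding stable_shifts_def by blast
  have "bounded (range unit_seq)"
    by (rule boundedI[of _ 1]) (auto simp: unit_seq_def)
  note le = le[OF this]
  have "(\<Sum>\<^sub>\<infinity>i. unit_seq i * \<phi> (x - of_int i)) = (\<Sum>\<^sub>\<infinity>i\<in>{0}. unit_seq i * \<phi> (x - of_int i))" for x
    by (rule infsum_cong_neutral) (auto simp: unit_seq_def)
  then have eq: "(\<lambda>x. \<Sum>\<^sub>\<infinity>i. unit_seq i * \<phi> (x - of_int i)) = \<phi>"
    by (simp add: unit_seq_def)
  have "sup_norm unit_seq \<le> 1"
    unfolding sup_norm_on_def by (rule SUP_least) (auto simp: unit_seq_def)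
  then have "sup_norm \<phi> \<le> ennreal C2"
    using le unfolding eq by (metis mult.right_neutral mult_left_mono order_trans zero_le)
  then have "ennreal \<bar>\<phi> x\<bar> \<le> ennreal C2" for x
    unfolding sup_norm_on_def by (auto simp: SUP_le_iff)
  then show ?thesis using that[of C2] C2 by simp
qed

lemma holder_continuousD:
  assumes "holder_continuous \<alpha> f" and "\<alpha> > 0" and "e > 0"
  obtains d where "d > 0" "\<And>x y. \<bar>x - y\<bar> < d \<Longrightarrow> \<bar>f x - f y\<bar> \<le> e"
proof -
  obtain C where C: "\<And>x y. \<bar>f x - f y\<bar> \<le> C * \<bar>x - y\<bar> powr \<alpha>"
    using assms(1) unfolding holder_continuous_def by blast
  define d where "d = (e / (\<bar>C\<bar> + 1)) powr (1 / \<alpha>)"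
  have d: "d > 0" using assms by (simp add: d_def)
  moreover have "\<bar>f x - f y\<bar> \<le> e" if "\<bar>x - y\<bar> < d" for x y
  proof -
    have "\<bar>x - y\<bar> powr \<alpha> \<le> d powr \<alpha>" using that assms(2) by (intro powr_mono2) auto
    also have "\<dots> = e / (\<bar>C\<bar> + 1)" using assms by (simp add: d_def powr_powr)
    finally have "(\<bar>C\<bar> + 1) * \<bar>x - y\<bar> powr \<alpha> \<le> e" by (simp add: field_simps)
    moreover have "C * \<bar>x - y\<bar> powr \<alpha> \<le> (\<bar>C\<bar> + 1) * \<bar>x - y\<bar> powr \<alpha>"
      by (intro mult_right_mono) auto
    ultimately show ?thesis using C[of x y] by linarith
  qed
  ultimately show thesis by (rule that)
qed

section \<open>Reproduction and partitions of unity\<close>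

lemma eventually_stencil_width_less:
  fixes d :: real
  assumes "d > 0"
  shows "\<forall>\<^sub>F n in sequentially. (real M + 1) / 2 ^ n < d"
proof -
  have "(\<lambda>n. (real M + 1) * inverse (2 ^ n)) \<longlonglongrightarrow> (real M + 1) * 0"
    by (intro tendsto_intros LIMSEQ_inverse_realpow_zero) simp
  then have "\<forall>\<^sub>F n in sequentially. (real M + 1) * inverse (2 ^ n) < d"
    using assms by (intro order_tendstoD(2)) auto
  then show ?thesis by (simp add: divide_inverse)
qed

text \<open>Let \<open>x = l / 2\<^bsup>m+q\<^esup>\<close>. The data at level \<open>m\<close> on the stencil of \<open>l\<close> and the refined value at \<open>l\<close>
  are all close to \<open>g x\<close>. As the latter is the sum of the former weighted by the impulse
  response, \<open>g x\<close> is close to the sum of the weights times \<open>g x\<close>, and one can divide by \<open>g x\<close>. The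
  restriction to \<open>\<bar>x\<bar> \<le> M\<close> keeps \<open>g\<close> bounded away from \<open>0\<close>; no position is lost by it, because an
  impulse response that starts at level \<open>m'\<close> lives where \<open>\<bar>x\<bar> \<le> M / 2\<^bsup>m'\<^esup>\<close>. The estimate carries the
  bound \<open>K\<close> of the weights explicitly because a bound independent of \<open>q\<close> is only derived later.\<close>

lemma impulse_response_nearly_partition_of_unity:
  fixes g :: "real \<Rightarrow> 'a::real_normed_vector"
  assumes a: "\<And>k. mask_supported M (a k)"
    and lim: "is_limit_function a f g" and nz: "\<And>x. g x \<noteq> 0" and "e > 0"
  shows "\<forall>\<^sub>F m in sequentially. \<forall>q l K.
    (\<forall>i. \<bar>impulse_response a m q i\<bar> \<le> K) \<longrightarrow> \<bar>of_int l / 2 ^ (m + q)\<bar> \<le> real M \<longrightarrow>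
    \<bar>(\<Sum>j\<in>stencil M q l. impulse_response a m q (l - 2 ^ q * j)) - 1\<bar> \<le> e * (K + 1)"
proof -
  let ?W = "2 * real M + 2"
  \<comment> \<open>If \<open>\<bar>x\<bar> \<le> M\<close>, the stencil points differ from \<open>x\<close> by at most \<open>(M + 1) / 2\<^sup>m \<le> M + 1\<close>.\<close>
  define R where "R = 2 * real M + 1"
  have R: "R > 0" by (simp add: R_def)
  have cont: "continuous_on {-R..R} g"
    using lim unfolding is_limit_function_def by (blast intro: continuous_on_subset)
  obtain c where c: "c > 0" "\<And>x. \<bar>x\<bar> \<le> R \<Longrightarrow> c \<le> norm (g x)"
  proof -
    have "\<exists>x\<in>{-R..R}. \<forall>y\<in>{-R..R}. norm (g x) \<le> norm (g y)"
      using R by (intro continuous_attains_inf continuous_on_norm cont) auto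
    then obtain x where "\<forall>y\<in>{-R..R}. norm (g x) \<le> norm (g y)" by blast
    then show thesis using that[of "norm (g x)"] nz[of x] by (simp add: abs_le_iff)
  qed
  \<comment> \<open>If data and refined values are within \<open>d\<close> of \<open>g\<close>, and \<open>g\<close> varies by at most \<open>d\<close> on a stencil,
    then the sum of the weights times \<open>g x\<close> differs from \<open>g x\<close> by at most \<open>d + ?W * K * 2 d\<close>.\<close>
  define d where "d = c * e / (2 * ?W)"
  have d: "d > 0" using c \<open>e > 0\<close> by (simp add: d_def)
  have "uniformly_continuous_on {-R..R} g"
    by (rule compact_uniformly_continuous[OF cont]) simp
  then obtain s where s: "s > 0"
    "\<forall>x\<in>{-R..R}. \<forall>y\<in>{-R..R}. norm (y - x) < s \<longrightarrow> norm (g y - g x) < d"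
    unfolding uniformly_continuous_on_def dist_norm using d by blast
  have near: "\<forall>\<^sub>F k in sequentially. \<forall>i. \<bar>of_int i / 2 ^ k\<bar> \<le> R \<longrightarrow>
      norm (g (of_int i / 2 ^ k) - subdiv_iter a k f i) \<le> d"
    by (rule is_limit_function_local[OF lim d R])
  have "\<forall>\<^sub>F m in sequentially. \<forall>k\<ge>m. \<forall>i. \<bar>of_int i / 2 ^ k\<bar> \<le> R \<longrightarrow>
      norm (g (of_int i / 2 ^ k) - subdiv_iter a k f i) \<le> d"
    using near by (rule eventually_all_ge_at_top)
  then show ?thesis using eventually_stencil_width_less[OF s(1), of M]
  proof eventually_elim
    case (elim m)
    show ?case
    proof (intro allI impI)
      fix q l K
      assume K: "\<forall>i. \<bar>impulse_response a m q i\<bar> \<le> K" and l: "\<bar>of_int l / 2 ^ (m + q)\<bar> \<le> real M"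
      let ?u = "\<lambda>j. impulse_response a m q (l - 2 ^ q * j)"
      let ?F = "stencil M q l"
      define x :: real where "x = of_int l / 2 ^ (m + q)"
      define H where "H = (\<Sum>j\<in>?F. ?u j)"
      have K0: "K \<ge> 0" using K[rule_format, of 0] by linarith
      have x: "\<bar>x\<bar> \<le> R" using l unfolding x_def R_def by linarith
      have step: "norm (subdiv_iter a m f j - g x) \<le> 2 * d" if j: "j \<in> ?F" for j
      proof -
        define y :: real where "y = of_int j / 2 ^ m"
        have "y - x = (of_int j - of_int l / 2 ^ q) / 2 ^ m"
          by (simp add: x_def y_def power_add field_simps)
        then have "\<bar>y - x\<bar> = \<bar>of_int j - of_int l / 2 ^ q\<bar> / 2 ^ m" by simp
        also have "\<dots> \<le> (real M + 1) / 2 ^ m"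
          by (intro divide_right_mono stencil_near[OF j]) simp
        finally have yx: "\<bar>y - x\<bar> \<le> (real M + 1) / 2 ^ m" .
        also have "\<dots> \<le> real M + 1"
          using divide_left_mono[of 1 "2 ^ m" "real M + 1"] by simp
        finally have y: "\<bar>y\<bar> \<le> R" using l unfolding R_def x_def[symmetric] by linarith
        have "x \<in> {-R..R}" "y \<in> {-R..R}" using x y by (simp_all only: atLeastAtMost_iff abs_le_iff) auto
        moreover have "norm (y - x) < s" using yx elim(2) by simp
        ultimately have "norm (g y - g x) < d" using s(2) by blast
        moreover have "norm (g y - subdiv_iter a m f j) \<le> d"
          using elim(1) y unfolding y_def by blast
        ultimately show ?thesis by norm
      qed
      have "(\<Sum>j\<in>?F. ?u j *\<^sub>R (subdiv_iter a m f j - g x)) = subdiv_iter a (m + q) f l - H *\<^sub>R g x"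
        unfolding subdiv_iter_add_eq_stencil_sum[OF a] H_def
        by (simp add: scaleR_diff_right sum_subtractf scaleR_sum_left)
      moreover have "norm (\<Sum>j\<in>?F. ?u j *\<^sub>R (subdiv_iter a m f j - g x)) \<le> ?W * (K * (2 * d))"
        using K step K0 by (intro norm_stencil_sum_le) (auto intro!: mult_mono)
      ultimately have "norm (subdiv_iter a (m + q) f l - H *\<^sub>R g x) \<le> ?W * (K * (2 * d))" by simp
      moreover have "norm (g x - subdiv_iter a (m + q) f l) \<le> d"
        using elim(1)[rule_format, of "m + q" l] x by (simp add: x_def)
      ultimately have "norm (g x - H *\<^sub>R g x) \<le> d + ?W * (K * (2 * d))"
        by (blast intro: norm_diff_triangle_le)
      also have "\<dots> \<le> 2 * ?W * d + ?W * (K * (2 * d))" using d by simp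
      also have "2 * ?W * d + ?W * (K * (2 * d)) = (d * (2 * ?W)) * (K + 1)"
        by (simp add: algebra_simps)
      also have "d * (2 * ?W) = c * e" by (simp add: d_def)
      also have "c * e * (K + 1) = c * (e * (K + 1))" by simp
      finally have "norm ((1 - H) *\<^sub>R g x) \<le> c * (e * (K + 1))"
        by (simp add: scaleR_diff_left)
      moreover have "\<bar>H - 1\<bar> * c \<le> norm ((1 - H) *\<^sub>R g x)"
        using c(2)[OF x] by (simp add: abs_minus_commute mult_left_mono)
      ultimately have "c * \<bar>H - 1\<bar> \<le> c * (e * (K + 1))" by (simp add: mult.commute)
      then show "\<bar>(\<Sum>j\<in>?F. ?u j) - 1\<bar> \<le> e * (K + 1)"
        using c(1) unfolding H_def by (simp only: mult_le_cancel_left_pos)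
    qed
  qed
qed

section \<open>The uniform estimate\<close>

text \<open>Splitting the cascade after \<open>n\<close> steps, \<open>u\<^bsub>m,n\<^esub> j\<close> is replaced by \<open>\<phi> (l / 2\<^bsup>n+q\<^esup>)\<close> on the stencil,
  and the remaining weights sum up to nearly \<open>1\<close>. Both errors are proportional to the bound \<open>K\<close> of the
  weights, with a factor that does not depend on \<open>q\<close>.\<close>

lemma impulse_response_nearly_limit:
  fixes g :: "real \<Rightarrow> 'a::real_normed_vector"
  assumes a: "\<And>k. mask_supported M (a k)" and b: "mask_supported M b"
    and sim: "asymptotically_similar a b"
    and lim: "is_limit_function a f g" and nz: "\<And>x. g x \<noteq> 0"
    and phi: "basic_limit_function (\<lambda>_. b) 0 \<phi>"
    and bnd: "\<And>x. \<bar>\<phi> x\<bar> \<le> C"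
    and uc: "uniformly_continuous_on UNIV \<phi>"
    and "e > 0"
  shows "\<exists>n>0. \<forall>\<^sub>F m in sequentially. \<forall>q l K.
    (\<forall>i. \<bar>impulse_response a (m + n) q i\<bar> \<le> K) \<longrightarrow> \<bar>of_int l / 2 ^ (n + q)\<bar> \<le> real M \<longrightarrow>
    \<bar>impulse_response a m (n + q) l - \<phi> (of_int l / 2 ^ (n + q))\<bar> \<le> e * (K + 1)"
proof -
  let ?W = "2 * real M + 2"
  have C: "C \<ge> 0" using bnd[of 0] by linarith
  \<comment> \<open>Each term of the stencil sum is off by \<open>3 d K\<close>, and the sum of the weights by \<open>d (K + 1)\<close>, which
    is multiplied by a value of \<open>\<phi>\<close>.\<close>
  define d where "d = e / (?W * 3 + C)"
  have d: "d > 0" using C \<open>e > 0\<close> by (simp add: d_def)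
  obtain s where s: "s > 0" "\<forall>x\<in>UNIV. \<forall>y\<in>UNIV. \<bar>y - x\<bar> < s \<longrightarrow> \<bar>\<phi> y - \<phi> x\<bar> < d"
    using uc d unfolding uniformly_continuous_on_def dist_real_def by blast
  have "\<forall>\<^sub>F n in sequentially. n > 0 \<and> (real M + 1) / 2 ^ n < s \<and>
      (\<forall>i. \<bar>\<phi> (of_int i / 2 ^ n) - impulse_response (\<lambda>_. b) 0 n i\<bar> \<le> d)"
    by (intro eventually_conj eventually_gt_at_top eventually_stencil_width_less s(1)
        basic_limit_functionD(2)[OF phi d])
  then obtain n where n: "n > 0" "(real M + 1) / 2 ^ n < s"
      "\<And>i. \<bar>\<phi> (of_int i / 2 ^ n) - impulse_response (\<lambda>_. b) 0 n i\<bar> \<le> d"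
    by (metis (mono_tags, lifting) eventually_sequentially order_refl)
  have "\<forall>\<^sub>F m in sequentially. \<forall>q l K.
      (\<forall>i. \<bar>impulse_response a m q i\<bar> \<le> K) \<longrightarrow> \<bar>of_int l / 2 ^ (m + q)\<bar> \<le> real M \<longrightarrow>
      \<bar>(\<Sum>j\<in>stencil M q l. impulse_response a m q (l - 2 ^ q * j)) - 1\<bar> \<le> d * (K + 1)"
    by (rule impulse_response_nearly_partition_of_unity[OF a lim nz d])
  moreover have "\<forall>\<^sub>F m in sequentially. \<forall>i.
      \<bar>impulse_response a m n i - impulse_response (\<lambda>_. b) 0 n i\<bar> \<le> d"
    by (rule impulse_response_tendsto_stationary[OF a b sim d])
  ultimately have "\<forall>\<^sub>F m in sequentially.
      (\<forall>q l K. (\<forall>i. \<bar>impulse_response a m q i\<bar> \<le> K) \<longrightarrow> \<bar>of_int l / 2 ^ (m + q)\<bar> \<le> real M \<longrightarrow>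
        \<bar>(\<Sum>j\<in>stencil M q l. impulse_response a m q (l - 2 ^ q * j)) - 1\<bar> \<le> d * (K + 1)) \<and>
      (\<forall>i. \<bar>impulse_response a m n i - impulse_response (\<lambda>_. b) 0 n i\<bar> \<le> d)"
    by (rule eventually_conj)
  then obtain m0 where
    pu: "\<And>m q l K. \<lbrakk>m \<ge> m0; \<And>i. \<bar>impulse_response a m q i\<bar> \<le> K;
        \<bar>of_int l / 2 ^ (m + q)\<bar> \<le> real M\<rbrakk> \<Longrightarrow>
      \<bar>(\<Sum>j\<in>stencil M q l. impulse_response a m q (l - 2 ^ q * j)) - 1\<bar> \<le> d * (K + 1)"
    and st: "\<And>m i. m \<ge> m0 \<Longrightarrow> \<bar>impulse_response a m n i - impulse_response (\<lambda>_. b) 0 n i\<bar> \<le> d"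
    unfolding eventually_sequentially by blast
  have "\<forall>m\<ge>m0. \<forall>q l K.
    (\<forall>i. \<bar>impulse_response a (m + n) q i\<bar> \<le> K) \<longrightarrow> \<bar>of_int l / 2 ^ (n + q)\<bar> \<le> real M \<longrightarrow>
    \<bar>impulse_response a m (n + q) l - \<phi> (of_int l / 2 ^ (n + q))\<bar> \<le> e * (K + 1)"
  proof (intro allI impI)
    fix m q l K
    assume m: "m \<ge> m0" and K: "\<forall>i. \<bar>impulse_response a (m + n) q i\<bar> \<le> K"
      and l: "\<bar>of_int l / 2 ^ (n + q)\<bar> \<le> real M"
    let ?F = "stencil M q l" and ?y = "of_int l / 2 ^ (n + q) :: real"
    let ?v = "\<lambda>j. impulse_response a (m + n) q (l - 2 ^ q * j)" and ?u = "impulse_response a m n"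
    define H where "H = (\<Sum>j\<in>?F. ?v j)"
    have K0: "K \<ge> 0" using K[rule_format, of 0] by linarith
    have near: "\<bar>?u j - \<phi> ?y\<bar> \<le> 3 * d" if j: "j \<in> ?F" for j
    proof -
      have "of_int j / 2 ^ n - ?y = (of_int j - of_int l / 2 ^ q) / 2 ^ n"
        by (simp add: power_add field_simps)
      then have "\<bar>of_int j / 2 ^ n - ?y\<bar> = \<bar>of_int j - of_int l / 2 ^ q\<bar> / 2 ^ n" by simp
      also have "\<dots> \<le> (real M + 1) / 2 ^ n"
        by (intro divide_right_mono stencil_near[OF j]) simp
      finally have "\<bar>\<phi> (of_int j / 2 ^ n) - \<phi> ?y\<bar> \<le> d" using n(2) by (intro less_imp_le s(2)[rule_format]) simp_all
      then show ?thesis using n(3)[of j] st[OF m, of j] by linarith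
    qed
    have "of_int l / 2 ^ (m + n + q) = ?y / 2 ^ m" by (simp add: power_add)
    then have "\<bar>of_int l / 2 ^ (m + n + q)\<bar> = \<bar>?y\<bar> / 2 ^ m" by (simp only: abs_divide) simp
    also have "\<dots> \<le> \<bar>?y\<bar>" using divide_left_mono[of 1 "2 ^ m" "\<bar>?y\<bar>"] by simp
    finally have "\<bar>of_int l / 2 ^ (m + n + q)\<bar> \<le> real M" using l by (rule order_trans)
    then have H: "\<bar>H - 1\<bar> \<le> d * (K + 1)"
      unfolding H_def using m by (intro pu K[rule_format]) auto
    have "impulse_response a m (n + q) l - \<phi> ?y
        = (\<Sum>j\<in>?F. ?v j * (?u j - \<phi> ?y)) + \<phi> ?y * (H - 1)"
      unfolding impulse_response_add[OF a] H_def
      by (simp add: algebra_simps sum_subtractf sum_distrib_left)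
    moreover have "norm (\<Sum>j\<in>?F. ?v j * (?u j - \<phi> ?y)) \<le> ?W * (K * (3 * d))"
      using K near K0 by (intro norm_stencil_sum_le) (auto simp: abs_mult intro!: mult_mono)
    moreover have "\<bar>\<phi> ?y * (H - 1)\<bar> \<le> C * (d * (K + 1))"
      unfolding abs_mult using bnd H C by (intro mult_mono) auto
    ultimately have "\<bar>impulse_response a m (n + q) l - \<phi> ?y\<bar>
        \<le> ?W * (K * (3 * d)) + C * (d * (K + 1))"
      by (simp only: real_norm_def)
    also have "\<dots> \<le> ?W * ((K + 1) * (3 * d)) + C * (d * (K + 1))"
      using d by (intro add_right_mono mult_left_mono mult_right_mono) auto
    also have "\<dots> = d * (?W * 3 + C) * (K + 1)" by (simp add: algebra_simps)
    also have "d * (?W * 3 + C) = e" using C by (simp add: d_def)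
    finally show "\<bar>impulse_response a m (n + q) l - \<phi> ?y\<bar> \<le> e * (K + 1)" .
  qed
  then show ?thesis using n(1) unfolding eventually_sequentially by blast
qed

text \<open>With \<open>\<epsilon> = 1 / 2\<close>, the preceding estimate says that a bound \<open>K\<close> for \<open>q\<close> steps from level \<open>m + n\<close>
  yields the bound \<open>C + (K + 1) / 2\<close> for \<open>n + q\<close> steps from level \<open>m\<close>. Any \<open>K \<ge> 2 C + 1\<close>
  is reproduced, so it suffices to start the induction on the number of steps with one that also
  covers fewer than \<open>n\<close> steps. Inducting on the number of steps with the starting level arbitrary
  avoids any a priori control of the growth of the bounds in \<open>m\<close>.\<close>

lemma impulse_response_uniformly_bounded:
  fixes g :: "real \<Rightarrow> 'a::real_normed_vector"
  assumes a: "\<And>k. mask_supported M (a k)" and b: "mask_supported M b"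
    and sim: "asymptotically_similar a b"
    and lim: "is_limit_function a f g" and nz: "\<And>x. g x \<noteq> 0"
    and phi: "basic_limit_function (\<lambda>_. b) 0 \<phi>"
    and bnd: "\<And>x. \<bar>\<phi> x\<bar> \<le> C"
    and uc: "uniformly_continuous_on UNIV \<phi>"
  shows "\<exists>K. \<forall>\<^sub>F m in sequentially. \<forall>q i. \<bar>impulse_response a m q i\<bar> \<le> K"
proof -
  have C: "C \<ge> 0" using bnd[of 0] by linarith
  define P where "P n m \<longleftrightarrow> (\<forall>q l K. (\<forall>i. \<bar>impulse_response a (m + n) q i\<bar> \<le> K) \<longrightarrow>
    \<bar>of_int l / 2 ^ (n + q)\<bar> \<le> real M \<longrightarrow>
    \<bar>impulse_response a m (n + q) l - \<phi> (of_int l / 2 ^ (n + q))\<bar> \<le> 1 / 2 * (K + 1))" for n m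
  have "\<exists>n>0. \<forall>\<^sub>F m in sequentially. P n m"
    unfolding P_def by (rule impulse_response_nearly_limit[OF a b sim lim nz phi bnd uc]) simp
  then obtain n m1 where n: "n > 0" and m1: "\<And>m. m \<ge> m1 \<Longrightarrow> P n m"
    unfolding eventually_sequentially by blast
  have step: "\<bar>impulse_response a m (n + q) l - \<phi> (of_int l / 2 ^ (n + q))\<bar> \<le> 1 / 2 * (K + 1)"
    if "m \<ge> m1" "\<And>i. \<bar>impulse_response a (m + n) q i\<bar> \<le> K" "\<bar>of_int l / 2 ^ (n + q)\<bar> \<le> real M"
    for m q l K
    using m1[OF that(1)] that(2,3) unfolding P_def by blast
  obtain B where B: "B \<ge> 0" "\<And>i. \<bar>b i\<bar> \<le> B" using mask_bounded[OF b] by blast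
  obtain m2 where m2: "\<And>k i. k \<ge> m2 \<Longrightarrow> \<bar>a k i - b i\<bar> \<le> 1"
    using asymptotically_similarD[OF sim, of 1] unfolding eventually_sequentially by auto
  have A: "\<bar>a k i\<bar> \<le> B + 1" if "k \<ge> m2" for k i
    using m2[OF that, of i] B(2)[of i] by linarith
  define G where "G = (2 * real M + 2) * (B + 1)"
  have "1 * 1 \<le> G" unfolding G_def using B by (intro mult_mono) auto
  then have G: "G \<ge> 1" by simp
  define K where "K = max (2 * C + 1) (G ^ n)"
  have "\<bar>impulse_response a m q l\<bar> \<le> K" if "m \<ge> max m1 m2" for m q l
    using that
  proof (induction q arbitrary: m l rule: less_induct)
    case (less q)
    show ?case
    proof (cases "q < n")
      case True
      have "\<bar>impulse_response a m q l\<bar> \<le> G ^ q"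
        unfolding G_def by (rule impulse_response_le_power[OF a A]) (use less.prems in auto)
      also have "\<dots> \<le> G ^ n" using G True by (intro power_increasing) auto
      finally show ?thesis by (simp add: K_def)
    next
      case False
      then have q: "q = n + (q - n)" "q - n < q" using n by auto
      show ?thesis
      proof (cases "impulse_response a m q l = 0")
        case True
        then show ?thesis using C by (simp add: K_def)
      next
        case False
        have "\<bar>l\<bar> \<le> int M * (2 ^ q - 1)" by (rule impulse_response_support[OF a False])
        also have "\<dots> \<le> int M * 2 ^ q" by (simp add: mult_left_mono)
        finally have "real_of_int \<bar>l\<bar> \<le> of_int (int M * 2 ^ q)" by (simp only: of_int_le_iff)
        then have "\<bar>of_int l / 2 ^ (n + (q - n))\<bar> \<le> real M"
          unfolding q(1)[symmetric] by (simp add: field_simps)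
        then have "\<bar>impulse_response a m q l - \<phi> (of_int l / 2 ^ q)\<bar> \<le> 1 / 2 * (K + 1)"
          using step[of m "q - n" K l] less.IH[OF q(2), of "m + n"] less.prems
          unfolding q(1)[symmetric] by simp
        moreover have "2 * C + 1 \<le> K" by (simp add: K_def)
        moreover have "\<bar>impulse_response a m q l\<bar>
            \<le> \<bar>impulse_response a m q l - \<phi> (of_int l / 2 ^ q)\<bar> + \<bar>\<phi> (of_int l / 2 ^ q)\<bar>"
          by linarith
        ultimately show ?thesis using bnd[of "of_int l / 2 ^ q"] by argo
      qed
    qed
  qed
  then show ?thesis unfolding eventually_sequentially by blast
qed

section \<open>From dyadic points to the real line\<close>

lemma continuous_le_if_le_on_dyadics:
  fixes h :: "real \<Rightarrow> real"
  assumes cont: "continuous_on UNIV h" and le: "\<And>l j. h (of_int l / 2 ^ j) \<le> c"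
  shows "h x \<le> c"
proof (rule tendsto_upperbound)
  let ?y = "\<lambda>j. of_int \<lfloor>2 ^ j * x\<rfloor> / 2 ^ j :: real"
  have "?y \<longlonglongrightarrow> x"
  proof (rule tendsto_sandwich)
    have "(\<lambda>j. x - inverse (2 ^ j)) \<longlonglongrightarrow> x - 0"
      by (intro tendsto_intros LIMSEQ_inverse_realpow_zero) simp
    then show "(\<lambda>j. x - inverse (2 ^ j)) \<longlonglongrightarrow> x" by simp
    have "x - inverse (2 ^ j) \<le> ?y j" for j
    proof -
      have "2 ^ j * x - 1 \<le> of_int \<lfloor>2 ^ j * x\<rfloor>" by linarith
      then have "(2 ^ j * x - 1) / 2 ^ j \<le> ?y j" by (intro divide_right_mono) auto
      moreover have "x - inverse (2 ^ j) = (2 ^ j * x - 1) / 2 ^ j"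
        by (simp add: diff_divide_distrib inverse_eq_divide)
      ultimately show ?thesis by simp
    qed
    then show "\<forall>\<^sub>F j in sequentially. x - inverse (2 ^ j) \<le> ?y j" by simp
    have "?y j \<le> x" for j
      using of_int_floor_le[of "2 ^ j * x"] by (simp add: field_simps)
    then show "\<forall>\<^sub>F j in sequentially. ?y j \<le> x" by simp
  qed simp
  then show "(\<lambda>j. h (?y j)) \<longlonglongrightarrow> h x"
    by (rule continuous_on_tendsto_compose[OF cont]) auto
qed (use le in auto)

lemma basic_limit_function_dyadic:
  assumes "basic_limit_function a m \<phi>"
  shows "(\<lambda>n. impulse_response a m (j + n) (l * 2 ^ n)) \<longlonglongrightarrow> \<phi> (of_int l / 2 ^ j)"
proof (rule LIMSEQ_I)
  fix r :: real assume "r > 0"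
  then have "\<forall>\<^sub>F n in sequentially. \<forall>i. \<bar>\<phi> (of_int i / 2 ^ n) - impulse_response a m n i\<bar> \<le> r / 2"
    by (intro basic_limit_functionD(2)[OF assms]) simp
  then obtain N where N: "\<And>n i. n \<ge> N \<Longrightarrow> \<bar>\<phi> (of_int i / 2 ^ n) - impulse_response a m n i\<bar> \<le> r / 2"
    unfolding eventually_sequentially by blast
  have "norm (impulse_response a m (j + n) (l * 2 ^ n) - \<phi> (of_int l / 2 ^ j)) < r" if "n \<ge> N" for n
  proof -
    have "of_int (l * 2 ^ n) / 2 ^ (j + n) = (of_int l / 2 ^ j :: real)" by (simp add: power_add)
    then show ?thesis using N[of "j + n" "l * 2 ^ n"] that \<open>r > 0\<close>
      by (simp only: real_norm_def) linarith
  qed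
  then show "\<exists>N. \<forall>n\<ge>N. norm (impulse_response a m (j + n) (l * 2 ^ n) - \<phi> (of_int l / 2 ^ j)) < r"
    by blast
qed

lemma basic_limit_function_support:
  assumes "\<And>k. mask_supported M (a k)" and "basic_limit_function a m \<phi>"
    and "\<bar>of_int l / 2 ^ j\<bar> > real M"
  shows "\<phi> (of_int l / 2 ^ j) = 0"
proof -
  have "impulse_response a m (j + n) (l * 2 ^ n) = 0" for n
  proof (rule ccontr)
    assume "impulse_response a m (j + n) (l * 2 ^ n) \<noteq> 0"
    then have "\<bar>l * 2 ^ n\<bar> \<le> int M * (2 ^ (j + n) - 1)" by (rule impulse_response_support[OF assms(1)])
    also have "\<dots> \<le> int M * 2 ^ (j + n)" by (simp add: mult_left_mono)
    finally have "\<bar>l\<bar> * 2 ^ n \<le> (int M * 2 ^ j) * 2 ^ n" by (simp add: abs_mult power_add)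
    then have "\<bar>l\<bar> \<le> int M * 2 ^ j" by simp
    then have "real_of_int \<bar>l\<bar> \<le> of_int (int M * 2 ^ j)" by (simp only: of_int_le_iff)
    then show False using assms(3) by (simp add: field_simps)
  qed
  then show ?thesis
    using basic_limit_function_dyadic[OF assms(2), of j l] by (simp add: LIMSEQ_const_iff)
qed

theorem theorem20:
  fixes M :: nat and a :: "nat \<Rightarrow> int \<Rightarrow> real" and b :: "int \<Rightarrow> real"
    and lam :: complex and p \<alpha> :: real
    and \<phi>m :: "nat \<Rightarrow> real \<Rightarrow> real" and \<phi> :: "real \<Rightarrow> real"
  assumes "\<And>k. mask_supported M (a k)"
    and "p \<in> {0, - 1 / 2}"
    and "reproduces_exp a lam p"
    and "\<And>m. basic_limit_function a m (\<phi>m m)"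
    and "mask_supported M b"
    and "asymptotically_similar a b"
    and "convergent_scheme (\<lambda>_. b)"
    and "basic_limit_function (\<lambda>_. b) 0 \<phi>"
    and "stable_shifts \<phi>"
    and "0 < \<alpha>" and "\<alpha> < 1"
    and "holder_continuous \<alpha> \<phi>"
  shows "(\<lambda>m. sup_norm (\<lambda>x. \<phi>m m x - \<phi> x)) \<longlonglongrightarrow> 0"
  unfolding sup_norm_on_tendsto_0_iff
proof (intro allI impI)
  fix \<epsilon> :: real assume eps: "\<epsilon> > 0"
  note a = assms(1) and b = assms(5) and phim = assms(4) and phi = assms(8)
  obtain C where C: "\<And>x. \<bar>\<phi> x\<bar> \<le> C" using stable_shifts_bounded[OF assms(9)] by blast
  have uc: "uniformly_continuous_on UNIV \<phi>"
    unfolding uniformly_continuous_on_def dist_real_def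
  proof (intro allI impI)
    fix e :: real assume "e > 0"
    then obtain d where "d > 0" "\<And>x y. \<bar>x - y\<bar> < d \<Longrightarrow> \<bar>\<phi> x - \<phi> y\<bar> \<le> e / 2"
      using holder_continuousD[OF assms(12,10), of "e / 2"] by auto
    then show "\<exists>d>0. \<forall>x\<in>UNIV. \<forall>x'\<in>UNIV. \<bar>x' - x\<bar> < d \<longrightarrow> \<bar>\<phi> x' - \<phi> x\<bar> < e"
      using \<open>e > 0\<close> by (intro exI[of _ d]) fastforce
  qed
  let ?g = "\<lambda>x::real. exp (lam * of_real x)"
  have lim: "is_limit_function a (\<lambda>i. exp (lam * of_real (of_int i + p))) ?g"
    using assms(3) by (simp add: reproduces_exp_def)
  have nz: "?g x \<noteq> 0" for x by simp
  note setting = a b assms(6) lim nz phi C uc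
  obtain K m1 where K: "\<forall>m\<ge>m1. \<forall>q i. \<bar>impulse_response a m q i\<bar> \<le> K"
    using impulse_response_uniformly_bounded[OF setting] unfolding eventually_sequentially by blast
  have "\<bar>impulse_response a m1 0 0\<bar> \<le> K" using K by blast
  then have K0: "K \<ge> 0" by linarith
  have pos: "\<epsilon> / (K + 1) > 0" using eps K0 by simp
  obtain n m2 where nearly: "\<forall>m\<ge>m2. \<forall>q l K'.
    (\<forall>i. \<bar>impulse_response a (m + n) q i\<bar> \<le> K') \<longrightarrow> \<bar>of_int l / 2 ^ (n + q)\<bar> \<le> real M \<longrightarrow>
    \<bar>impulse_response a m (n + q) l - \<phi> (of_int l / 2 ^ (n + q))\<bar> \<le> \<epsilon> / (K + 1) * (K' + 1)"
    using impulse_response_nearly_limit[OF setting pos] unfolding eventually_sequentially by blast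
  have step: "\<bar>impulse_response a m (n + q) l - \<phi> (of_int l / 2 ^ (n + q))\<bar> \<le> \<epsilon>"
    if m: "m \<ge> max m1 m2" and l: "\<bar>of_int l / 2 ^ (n + q)\<bar> \<le> real M" for m q l
  proof -
    have "\<forall>i. \<bar>impulse_response a (m + n) q i\<bar> \<le> K" using K m by simp
    then have "\<bar>impulse_response a m (n + q) l - \<phi> (of_int l / 2 ^ (n + q))\<bar> \<le> \<epsilon> / (K + 1) * (K + 1)"
      using nearly l m by (meson max.boundedE)
    then show ?thesis using K0 by simp
  qed
  have main: "\<bar>\<phi>m m x - \<phi> x\<bar> \<le> \<epsilon>" if m: "m \<ge> max m1 m2" for m x
  proof (rule continuous_le_if_le_on_dyadics[where h = "\<lambda>x. \<bar>\<phi>m m x - \<phi> x\<bar>"])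
    show "continuous_on UNIV (\<lambda>x. \<bar>\<phi>m m x - \<phi> x\<bar>)"
      by (intro continuous_intros basic_limit_functionD(1)[OF phim] basic_limit_functionD(1)[OF phi])
    fix l j
    show "\<bar>\<phi>m m (of_int l / 2 ^ j) - \<phi> (of_int l / 2 ^ j)\<bar> \<le> \<epsilon>"
    proof (cases "\<bar>of_int l / 2 ^ j\<bar> \<le> real M")
      case False
      then show ?thesis
        using basic_limit_function_support[OF a phim, of l j m]
          basic_limit_function_support[OF b phi, of l j] eps by simp
    next
      case True
      \<comment> \<open>At level \<open>j + q\<close> the point \<open>l / 2\<^sup>j\<close> has index \<open>l * 2\<^sup>q\<close>; the first \<open>n\<close> of the \<open>j + q\<close> steps are
        split off.\<close>
      have "\<bar>impulse_response a m (j + q) (l * 2 ^ q) - \<phi> (of_int l / 2 ^ j)\<bar> \<le> \<epsilon>" if q: "q \<ge> n" for q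
      proof -
        have jq: "n + (j + (q - n)) = j + q" using q by simp
        have x: "of_int (l * 2 ^ q) / 2 ^ (j + q) = (of_int l / 2 ^ j :: real)"
          by (simp add: power_add)
        show ?thesis
          using step[OF m, of "l * 2 ^ q" "j + (q - n)"] True unfolding jq x by blast
      qed
      then show ?thesis
        by (intro tendsto_upperbound[OF tendsto_rabs[OF tendsto_diff[OF
                basic_limit_function_dyadic[OF phim] tendsto_const]]])
          (auto simp: eventually_sequentially)
    qed
  qed
  then show "\<forall>\<^sub>F m in sequentially. \<forall>x\<in>UNIV. norm (\<phi>m m x - \<phi> x) \<le> \<epsilon>"
    by (intro eventually_sequentiallyI[of "max m1 m2"]) simp
qed

end
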